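(* Let $A$ be an infinite set. (1) Let $\mathcal{L}\in V(\Omega(A))$. Then $\rho\colon\mathcal{L}\to\mathfrak{B}_{A}(Z(\mathcal{L}))$, $\rho(\ell)(\phi)=\phi(\ell)$, is a surjective homomorphism, and $\rho$ is an isomorphism if and only if $\mathcal{L}$ is partitionable. (2) Let $(X,\mathcal{U})$ be a uniform space. Then the mapping $\mathcal{C}\colon(X,\mathcal{U})\to Z(\mathfrak{B}_{A}(X,\mathcal{U}))$, $\mathcal{C}(x)(f)=f(x)$, is uniformly continuous and its image $\mathcal{C}(X)=\{\mathcal{C}(x)\mid x\in X\}$ is dense in $Z(\mathfrak{B}_{A}(X,\mathcal{U}))$. If $(X,\mathcal{U})$ is separated and non-Archimedean, then $\mathcal{C}$ is injective. If $(X,\mathcal{U})$ is separated, non-Archimedean and $|A|^{+}$-totally bounded, then $\mathcal{C}$ is an embedding of uniform spaces. If $(X,\mathcal{U})$ is complete, non-Archimedean and $|A|^{+}$-totally bounded, then $\mathcal{C}$ is an isomorphism of uniform spaces (a uniform homeomorphism).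
   Context: Uniform spaces are given by entourages; complete uniform spaces are assumed to be separated. A uniform space $(X,\mathcal{U})$ is non-Archimedean if $\mathcal{U}$ is generated by equivalence relations (i.e. every entourage contains an entourage that is an equivalence relation). For a cardinal $\lambda$, a non-Archimedean uniform space is $\lambda$-totally bounded if every equivalence relation $E\in\mathcal{U}$ partitions $X$ into fewer than $\lambda$ blocks. $|A|^{+}$ is the successor cardinal of $|A|$. $\Omega(A)$ is the algebra with universe $A$ whose signature has a constant symbol $\hat a$ for each $a\in A$, interpreted as $a$, and an $n$-ary function symbol $\hat f$ for each function $f\colon A^n\to A$ (all finite $n$), interpreted as $f$. $V(\Omega(A))$ is the variety generated by $\Omega(A)$. An algebra $\mathcal{L}\in V(\Omega(A))$ is partitionable if there is an injective homomorphism $\mathcal{L}\to\Omega(A)^{I}$ for some set $I$. For $\mathcal{L}\in V(\Omega(A))$, $Z(\mathcal{L})$ is the set of all homomorphisms $\phi\colon\mathcal{L}\to\Omega(A)$, with the uniformity it inherits as a subspace of $A^{\mathcal{L}}$, where $A$ has the discrete uniformity and $A^{\mathcal{L}}$ the product uniformity. For a uniform space $(X,\mathcal{U})$, $\mathfrak{B}_{A}(X,\mathcal{U})$ is the algebra of all uniformly continuous maps $X\to A$ ($A$ with the discrete uniformity), with pointwise operations, a subalgebra of $\Omega(A)^{X}$. For each $\ell\in\mathcal{L}$ the map $\phi\mapsto\phi(\ell)$ is uniformly continuous on $Z(\mathcal{L})$, and for each $x\in X$ the map $f\mapsto f(x)$ is a homomorphism $\mathfrak{B}_{A}(X,\mathcal{U})\to\Omega(A)$,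 so $\rho$ and $\mathcal{C}$ are well defined. *)

theory Defs
  imports "HOL-Analysis.Analysis" "HOL-Library.NList"
begin

unbundle cardinal_syntax

section \<open>Universal algebra\<close>

text \<open>
  A signature is a set of pairs (symbol, arity).  Algebras are carrier based; the value of an
  operation is only meaningful for symbols of the signature, applied to argument lists over the
  carrier whose length is the arity.
\<close>

type_synonym 'f signature = "('f \<times> nat) set"

record ('f, 'b) algebra =
  univ :: "'b set"
  opr :: "'f \<Rightarrow> 'b list \<Rightarrow> 'b"

definition is_algebra :: "'f signature \<Rightarrow> ('f, 'b) algebra \<Rightarrow> bool" where
  "is_algebra S L \<longleftrightarrow> (\<forall>(f, n) \<in> S. \<forall>xs \<in> nlists n (univ L). opr L f xs \<in> univ L)"

definition alg_hom ::
  "'f signature \<Rightarrow> ('f, 'b) algebra \<Rightarrow> ('f, 'c) algebra \<Rightarrow> ('b \<Rightarrow> 'c) \<Rightarrow> bool" where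
  "alg_hom S L M h \<longleftrightarrow> h \<in> univ L \<rightarrow> univ M \<and>
     (\<forall>(f, n) \<in> S. \<forall>xs \<in> nlists n (univ L). h (opr L f xs) = opr M f (map h xs))"

definition alg_iso ::
  "'f signature \<Rightarrow> ('f, 'b) algebra \<Rightarrow> ('f, 'c) algebra \<Rightarrow> ('b \<Rightarrow> 'c) \<Rightarrow> bool" where
  "alg_iso S L M h \<longleftrightarrow> alg_hom S L M h \<and> bij_betw h (univ L) (univ M)"

definition alg_power :: "('f, 'b) algebra \<Rightarrow> 'i set \<Rightarrow> ('f, 'i \<Rightarrow> 'b) algebra" where
  "alg_power M I = \<lparr> univ = I \<rightarrow>\<^sub>E univ M,
                     opr = (\<lambda>f xs. \<lambda>i\<in>I. opr M f (map (\<lambda>x. x i) xs)) \<rparr>"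

text \<open>Operations are finitary, so countably many variables suffice for identities.\<close>

datatype 'f trm = Var nat | App 'f "'f trm list"

inductive_set trms :: "'f signature \<Rightarrow> 'f trm set" for S where
  "Var i \<in> trms S"
| "\<lbrakk>(f, n) \<in> S; length ts = n; \<forall>t \<in> set ts. t \<in> trms S\<rbrakk> \<Longrightarrow> App f ts \<in> trms S"

primrec eval_trm :: "('f, 'b) algebra \<Rightarrow> (nat \<Rightarrow> 'b) \<Rightarrow> 'f trm \<Rightarrow> 'b" where
  "eval_trm L v (Var i) = v i"
| "eval_trm L v (App f ts) = opr L f (map (eval_trm L v) ts)"

definition satisfies :: "('f, 'b) algebra \<Rightarrow> 'f trm \<times> 'f trm \<Rightarrow> bool" where
  "satisfies L = (\<lambda>(s, t). \<forall>v. range v \<subseteq> univ L \<longrightarrow> eval_trm L v s = eval_trm L v t)"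

text \<open>
  Varieties are the equational classes.  The variety generated by \<open>M\<close> is the intersection of
  all varieties that contain \<open>M\<close>; its members may live on any carrier type.
\<close>

definition models_of :: "'f signature \<Rightarrow> ('f trm \<times> 'f trm) set \<Rightarrow> ('f, 'b) algebra set" where
  "models_of S E = {L. is_algebra S L \<and> (\<forall>e \<in> E. satisfies L e)}"

definition variety_gen :: "'f signature \<Rightarrow> ('f, 'c) algebra \<Rightarrow> ('f, 'b) algebra set" where
  "variety_gen S M =
     {L. is_algebra S L \<and> (\<forall>E \<subseteq> trms S \<times> trms S. M \<in> models_of S E \<longrightarrow> L \<in> models_of S E)}"


section \<open>The algebra \<open>\<Omega>(A)\<close>\<close>

datatype 'a opsym = ConstSym 'a | FunSym nat "'a list \<Rightarrow> 'a"

text \<open>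
  Functions on \<open>A\<^sup>n\<close> are extensional functions on lists of length \<open>n\<close>, so that there is exactly
  one symbol for every function.
\<close>

definition Omega_sig :: "'a set \<Rightarrow> 'a opsym signature" where
  "Omega_sig A = {(ConstSym a, 0) | a. a \<in> A} \<union>
                 {(FunSym n f, n) | n f. f \<in> nlists n A \<rightarrow>\<^sub>E A}"

definition Omega :: "'a set \<Rightarrow> ('a opsym, 'a) algebra" where
  "Omega A = \<lparr> univ = A,
     opr = (\<lambda>s xs. case s of ConstSym a \<Rightarrow> a | FunSym n f \<Rightarrow> f xs) \<rparr>"

definition V_Omega :: "'a set \<Rightarrow> ('a opsym, 'b) algebra set" where
  "V_Omega A = variety_gen (Omega_sig A) (Omega A)"

definition embeds_in_power :: "'a set \<Rightarrow> ('a opsym, 'b) algebra \<Rightarrow> 'i set \<Rightarrow> bool" where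
  "embeds_in_power A L I \<longleftrightarrow>
     (\<exists>h. alg_hom (Omega_sig A) L (alg_power (Omega A) I) h \<and> inj_on h (univ L))"

text \<open>
  HOL cannot quantify over the type of the index set inside a formula.  Index sets of maps from
  the carrier to \<open>A\<close> suffice: by the lemma below, an embedding into a power over an index set of
  any other type yields one of this type.
\<close>

definition partitionable :: "'a set \<Rightarrow> ('a opsym, 'b) algebra \<Rightarrow> bool" where
  "partitionable A L \<longleftrightarrow> (\<exists>I :: ('b \<Rightarrow> 'a) set. embeds_in_power A L I)"

lemma embeds_in_power_imp_partitionable:
  fixes L :: "('a opsym, 'b) algebra" and J :: "'i set"
  assumes alg: "is_algebra (Omega_sig A) L" and emb: "embeds_in_power A L J"
  shows "partitionable A L"
proof -
  obtain h where hom: "alg_hom (Omega_sig A) L (alg_power (Omega A) J) h"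
    and inj: "inj_on h (univ L)"
    using emb by (auto simp: embeds_in_power_def)
  define q where "q j = (\<lambda>l. h l j)" for j
  define k where "k l = (\<lambda>\<phi>\<in>q ` J. \<phi> l)" for l :: 'b
  have k_q: "k l (q j) = h l j" if "j \<in> J" for l j
    using that by (simp add: k_def) (simp add: q_def)
  have h_in: "h l \<in> J \<rightarrow>\<^sub>E A" if "l \<in> univ L" for l
    using hom that by (auto simp: alg_hom_def alg_power_def Omega_def)
  have k_in: "k l \<in> q ` J \<rightarrow>\<^sub>E A" if "l \<in> univ L" for l
    using h_in[OF that] by (auto simp: k_def q_def PiE_def Pi_def)
  have k_op: "k (opr L f xs) = opr (alg_power (Omega A) (q ` J)) f (map k xs)"
    if "(f, n) \<in> Omega_sig A" "xs \<in> nlists n (univ L)" for f n xs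
  proof -
    have h_op: "h (opr L f xs) j = opr (Omega A) f (map (\<lambda>x. h x j) xs)" if "j \<in> J" for j
    proof -
      have "h (opr L f xs) = opr (alg_power (Omega A) J) f (map h xs)"
        using hom \<open>(f, n) \<in> _\<close> \<open>xs \<in> _\<close> by (auto simp: alg_hom_def)
      then show ?thesis
        using that by (simp add: alg_power_def comp_def)
    qed
    show ?thesis
    proof
      fix p
      show "k (opr L f xs) p = opr (alg_power (Omega A) (q ` J)) f (map k xs) p"
      proof (cases "p \<in> q ` J")
        case True
        then obtain j where j: "j \<in> J" "p = q j" by blast
        then have "map (\<lambda>x. x p) (map k xs) = map (\<lambda>x. h x j) xs"
          by (simp add: k_q)
        moreover have "opr (alg_power (Omega A) (q ` J)) f (map k xs) p =
            opr (Omega A) f (map (\<lambda>x. x p) (map k xs))"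
          using True by (simp add: alg_power_def)
        ultimately show ?thesis
          using h_op[OF j(1)] j k_q[OF j(1)] by (simp del: map_map)
      next
        case False
        then show ?thesis by (simp add: k_def alg_power_def)
      qed
    qed
  qed
  have "alg_hom (Omega_sig A) L (alg_power (Omega A) (q ` J)) k"
    using k_in k_op by (auto simp: alg_hom_def) (auto simp: alg_power_def Omega_def)
  moreover have "inj_on k (univ L)"
  proof (rule inj_onI)
    fix x y assume xy: "x \<in> univ L" "y \<in> univ L" "k x = k y"
    have "h x j = h y j" if "j \<in> J" for j
      using fun_cong[OF xy(3), of "q j"] that by (simp add: k_q)
    then have "h x = h y"
      using h_in[OF xy(1)] h_in[OF xy(2)] by (blast intro: PiE_ext)
    then show "x = y"
      using inj xy by (auto dest: inj_onD)
  qed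
  ultimately show ?thesis
    unfolding partitionable_def embeds_in_power_def by blast
qed


section \<open>Uniform spaces\<close>

text \<open>
  The library's type class of uniform spaces has whole types as carriers; here the carrier is a
  possibly empty set \<open>X\<close> and \<open>U\<close> is its set of entourages.
\<close>

definition unif_structure :: "'x set \<Rightarrow> ('x \<times> 'x) set set \<Rightarrow> bool" where
  "unif_structure X U \<longleftrightarrow>
     U \<noteq> {} \<and>
     (\<forall>E \<in> U. Id_on X \<subseteq> E \<and> E \<subseteq> X \<times> X) \<and>
     (\<forall>E \<in> U. \<forall>F. E \<subseteq> F \<and> F \<subseteq> X \<times> X \<longrightarrow> F \<in> U) \<and>
     (\<forall>E \<in> U. \<forall>F \<in> U. E \<inter> F \<in> U) \<and>
     (\<forall>E \<in> U. E\<inverse> \<in> U) \<and>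
     (\<forall>E \<in> U. \<exists>D \<in> U. D O D \<subseteq> E)"

definition discrete_unif :: "'x set \<Rightarrow> ('x \<times> 'x) set set" where
  "discrete_unif X = {E. Id_on X \<subseteq> E \<and> E \<subseteq> X \<times> X}"

definition subspace_unif :: "'x set \<Rightarrow> ('x \<times> 'x) set set \<Rightarrow> ('x \<times> 'x) set set" where
  "subspace_unif Y U = {E \<inter> Y \<times> Y | E. E \<in> U}"

definition product_unif ::
  "'i set \<Rightarrow> ('i \<Rightarrow> 'x set) \<Rightarrow> ('i \<Rightarrow> ('x \<times> 'x) set set) \<Rightarrow> (('i \<Rightarrow> 'x) \<times> ('i \<Rightarrow> 'x)) set set" where
  "product_unif I X U =
     {E. E \<subseteq> Pi\<^sub>E I X \<times> Pi\<^sub>E I X \<and>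
         (\<exists>J D. finite J \<and> J \<subseteq> I \<and> (\<forall>j \<in> J. D j \<in> U j) \<and>
            {(g, h). g \<in> Pi\<^sub>E I X \<and> h \<in> Pi\<^sub>E I X \<and> (\<forall>j \<in> J. (g j, h j) \<in> D j)} \<subseteq> E)}"

definition unif_continuous ::
  "'x set \<Rightarrow> ('x \<times> 'x) set set \<Rightarrow> 'y set \<Rightarrow> ('y \<times> 'y) set set \<Rightarrow> ('x \<Rightarrow> 'y) \<Rightarrow> bool" where
  "unif_continuous X U Y V f \<longleftrightarrow> f \<in> X \<rightarrow> Y \<and>
     (\<forall>E \<in> V. {(x, x'). x \<in> X \<and> x' \<in> X \<and> (f x, f x') \<in> E} \<in> U)"

definition unif_iso ::
  "'x set \<Rightarrow> ('x \<times> 'x) set set \<Rightarrow> 'y set \<Rightarrow> ('y \<times> 'y) set set \<Rightarrow> ('x \<Rightarrow> 'y) \<Rightarrow> bool" where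
  "unif_iso X U Y V f \<longleftrightarrow> bij_betw f X Y \<and>
     unif_continuous X U Y V f \<and> unif_continuous Y V X U (inv_into X f)"

definition unif_embedding ::
  "'x set \<Rightarrow> ('x \<times> 'x) set set \<Rightarrow> 'y set \<Rightarrow> ('y \<times> 'y) set set \<Rightarrow> ('x \<Rightarrow> 'y) \<Rightarrow> bool" where
  "unif_embedding X U Y V f \<longleftrightarrow>
     f \<in> X \<rightarrow> Y \<and> unif_iso X U (f ` X) (subspace_unif (f ` X) V) f"

definition unif_topology :: "'x set \<Rightarrow> ('x \<times> 'x) set set \<Rightarrow> 'x topology" where
  "unif_topology X U = topology (\<lambda>G. G \<subseteq> X \<and> (\<forall>x \<in> G. \<exists>E \<in> U. E `` {x} \<subseteq> G))"

lemma openin_unif_topology: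
  assumes "unif_structure X U"
  shows "openin (unif_topology X U) G \<longleftrightarrow> G \<subseteq> X \<and> (\<forall>x \<in> G. \<exists>E \<in> U. E `` {x} \<subseteq> G)"
proof -
  define P where "P x G \<longleftrightarrow> (\<exists>E \<in> U. E `` {x} \<subseteq> G)" for x G
  have P_Int: "P x (G \<inter> H)" if G: "P x G" and H: "P x H" for x G H
  proof -
    obtain E F where EF: "E \<in> U" "E `` {x} \<subseteq> G" "F \<in> U" "F `` {x} \<subseteq> H"
      using G H unfolding P_def by blast
    then have "E \<inter> F \<in> U"
      using assms unfolding unif_structure_def by meson
    moreover have "(E \<inter> F) `` {x} \<subseteq> G \<inter> H"
      using EF by blast
    ultimately show ?thesis unfolding P_def by (rule bexI[rotated])
  qed
  have P_mono: "P x H" if "P x G" "G \<subseteq> H" for x G H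
    using that by (meson P_def order_trans)
  have "istopology (\<lambda>G. G \<subseteq> X \<and> (\<forall>x \<in> G. P x G))"
    unfolding istopology_def
  proof (intro conjI allI impI ballI)
    fix G H x
    assume "G \<subseteq> X \<and> (\<forall>x \<in> G. P x G)" "H \<subseteq> X \<and> (\<forall>x \<in> H. P x H)" "x \<in> G \<inter> H"
    then show "P x (G \<inter> H)" by (metis IntE P_Int)
  next
    fix K x
    assume "\<forall>G \<in> K. G \<subseteq> X \<and> (\<forall>x \<in> G. P x G)" "x \<in> \<Union>K"
    then show "P x (\<Union>K)" by (metis UnionE Union_upper P_mono)
  qed blast+
  then show ?thesis
    unfolding unif_topology_def P_def by (rule topology_inverse'[THEN fun_cong])
qed

lemma topspace_unif_topology:
  assumes "unif_structure X U"
  shows "topspace (unif_topology X U) = X"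
proof (rule antisym)
  show "topspace (unif_topology X U) \<subseteq> X"
    using openin_unif_topology[OF assms] openin_topspace by blast
  obtain E where "E \<in> U" "E \<subseteq> X \<times> X"
    using assms by (auto simp: unif_structure_def)
  then have "openin (unif_topology X U) X"
    by (auto simp: openin_unif_topology[OF assms])
  then show "X \<subseteq> topspace (unif_topology X U)"
    by (rule openin_subset)
qed

definition unif_separated :: "'x set \<Rightarrow> ('x \<times> 'x) set set \<Rightarrow> bool" where
  "unif_separated X U \<longleftrightarrow> \<Inter>U = Id_on X"

definition unif_cauchy_filter :: "'x set \<Rightarrow> ('x \<times> 'x) set set \<Rightarrow> 'x filter \<Rightarrow> bool" where
  "unif_cauchy_filter X U F \<longleftrightarrow> F \<noteq> bot \<and> F \<le> principal X \<and>
     (\<forall>E \<in> U. \<exists>S. eventually (\<lambda>x. x \<in> S) F \<and> S \<times> S \<subseteq> E)"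

definition unif_complete :: "'x set \<Rightarrow> ('x \<times> 'x) set set \<Rightarrow> bool" where
  "unif_complete X U \<longleftrightarrow> unif_separated X U \<and>
     (\<forall>F. unif_cauchy_filter X U F \<longrightarrow> (\<exists>x. limitin (unif_topology X U) (\<lambda>y. y) x F))"

definition non_archimedean :: "'x set \<Rightarrow> ('x \<times> 'x) set set \<Rightarrow> bool" where
  "non_archimedean X U \<longleftrightarrow> (\<forall>E \<in> U. \<exists>R \<in> U. equiv X R \<and> R \<subseteq> E)"

text \<open>The cardinal \<open>\<lambda>\<close> is given as a cardinal order, as usual in the library.\<close>

definition card_totally_bounded :: "'c rel \<Rightarrow> 'x set \<Rightarrow> ('x \<times> 'x) set set \<Rightarrow> bool" where
  "card_totally_bounded c X U \<longleftrightarrow> (\<forall>E \<in> U. equiv X E \<longrightarrow> |X // E| <o c)"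


section \<open>The two functors and their unit maps\<close>

definition Z :: "'a set \<Rightarrow> ('a opsym, 'b) algebra \<Rightarrow> ('b \<Rightarrow> 'a) set" where
  "Z A L = {\<phi> \<in> univ L \<rightarrow>\<^sub>E A. alg_hom (Omega_sig A) L (Omega A) \<phi>}"

definition Z_unif ::
  "'a set \<Rightarrow> ('a opsym, 'b) algebra \<Rightarrow> (('b \<Rightarrow> 'a) \<times> ('b \<Rightarrow> 'a)) set set" where
  "Z_unif A L =
     subspace_unif (Z A L) (product_unif (univ L) (\<lambda>_. A) (\<lambda>_. discrete_unif A))"

definition BA ::
  "'a set \<Rightarrow> 'x set \<Rightarrow> ('x \<times> 'x) set set \<Rightarrow> ('a opsym, 'x \<Rightarrow> 'a) algebra" where
  "BA A X U = (alg_power (Omega A) X)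
     \<lparr> univ := {f \<in> X \<rightarrow>\<^sub>E A. unif_continuous X U A (discrete_unif A) f} \<rparr>"

definition rho :: "'a set \<Rightarrow> ('a opsym, 'b) algebra \<Rightarrow> 'b \<Rightarrow> ('b \<Rightarrow> 'a) \<Rightarrow> 'a" where
  "rho A L l = (\<lambda>\<phi> \<in> Z A L. \<phi> l)"

definition canon ::
  "'a set \<Rightarrow> 'x set \<Rightarrow> ('x \<times> 'x) set set \<Rightarrow> 'x \<Rightarrow> ('x \<Rightarrow> 'a) \<Rightarrow> 'a" where
  "canon A X U x = (\<lambda>f \<in> univ (BA A X U). f x)"

section \<open>Well-definedness\<close>

text \<open>\<open>Z(L)\<close> is a uniform space, and \<open>Z\<close> may be applied to the algebra of uniformly continuous maps.\<close>

lemma unif_structureI: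
  assumes "U \<noteq> {}" "\<And>E. E \<in> U \<Longrightarrow> Id_on X \<subseteq> E" "\<And>E. E \<in> U \<Longrightarrow> E \<subseteq> X \<times> X"
   "\<And>E F. E \<in> U \<Longrightarrow> E \<subseteq> F \<Longrightarrow> F \<subseteq> X \<times> X \<Longrightarrow> F \<in> U"
   "\<And>E F. E \<in> U \<Longrightarrow> F \<in> U \<Longrightarrow> E \<inter> F \<in> U"
   "\<And>E. E \<in> U \<Longrightarrow> E\<inverse> \<in> U" "\<And>E. E \<in> U \<Longrightarrow> \<exists>D \<in> U. D O D \<subseteq> E"
  shows "unif_structure X U"
  unfolding unif_structure_def
  by (intro conjI ballI allI impI; (elim conjE)?; rule assms; assumption)

lemma unif_structureD:
  assumes "unif_structure X U"
  shows unif_structure_subset: "E \<in> U \<Longrightarrow> E \<subseteq> X \<times> X"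
   and unif_structure_mono: "E \<in> U \<Longrightarrow> E \<subseteq> F \<Longrightarrow> F \<subseteq> X \<times> X \<Longrightarrow> F \<in> U"
   and unif_structure_Int: "E \<in> U \<Longrightarrow> F \<in> U \<Longrightarrow> E \<inter> F \<in> U"
   and unif_structure_nonempty: "U \<noteq> {}"
  using assms unfolding unif_structure_def by meson+

lemma Z_unif_iff: "E \<in> Z_unif A L \<longleftrightarrow> E \<subseteq> Z A L \<times> Z A L \<and>
  (\<exists>J. finite J \<and> J \<subseteq> univ L \<and> {(g,h). g \<in> Z A L \<and> h \<in> Z A L \<and> (\<forall>j\<in>J. g j = h j)} \<subseteq> E)"
  (is "_ \<longleftrightarrow> ?R")
proof
  assume "E \<in> Z_unif A L"
  then obtain E' where E': "E = E' \<inter> Z A L \<times> Z A L"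
    "E' \<in> product_unif (univ L) (\<lambda>_. A) (\<lambda>_. discrete_unif A)"
    unfolding Z_unif_def subspace_unif_def by blast
  from E'(2) obtain J D where J: "finite J" "J \<subseteq> univ L" "\<forall>j\<in>J. D j \<in> discrete_unif A"
   and sub: "{(g, h). g \<in> univ L \<rightarrow>\<^sub>E A \<and> h \<in> univ L \<rightarrow>\<^sub>E A \<and> (\<forall>j \<in> J. (g j, h j) \<in> D j)} \<subseteq> E'"
    unfolding product_unif_def by (elim CollectE conjE exE) (rule that)
  note E = E'(1) J
  have "(g,h) \<in> E" if "g \<in> Z A L" "h \<in> Z A L" "\<forall>j\<in>J. g j = h j" for g h
  proof -
    have gh: "g \<in> univ L \<rightarrow>\<^sub>E A" "h \<in> univ L \<rightarrow>\<^sub>E A" using that by (auto simp: Z_def)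
    have "(g j, h j) \<in> D j" if "j \<in> J" for j
    proof -
      have "h j \<in> A" using gh E(3) that by blast
      moreover have "Id_on A \<subseteq> D j" using E(4) that by (simp add: discrete_unif_def)
      ultimately show ?thesis using \<open>\<forall>j\<in>J. g j = h j\<close> that by auto
    qed
    then have "(g,h) \<in> E'" using gh by (intro subsetD[OF sub]) simp
    then show ?thesis using that E(1) by simp
  qed
  then show ?R using E by (intro conjI exI[of _ J]) auto
next
  assume R: ?R
  then obtain J where J: "finite J" "J \<subseteq> univ L"
    "{(g,h). g \<in> Z A L \<and> h \<in> Z A L \<and> (\<forall>j\<in>J. g j = h j)} \<subseteq> E" by blast
  let ?P = "univ L \<rightarrow>\<^sub>E A"
  let ?E = "{(g,h). g \<in> ?P \<and> h \<in> ?P \<and> (\<forall>j\<in>J. (g j,h j) \<in> Id_on A)} \<union> E"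
  have ZP: "Z A L \<subseteq> ?P" by (auto simp: Z_def)
  have "?E \<subseteq> ?P \<times> ?P" using R ZP by blast
  moreover have "\<forall>j\<in>J. Id_on A \<in> discrete_unif A" by (auto simp: discrete_unif_def)
  ultimately have "?E \<in> product_unif (univ L) (\<lambda>_. A) (\<lambda>_. discrete_unif A)"
    unfolding product_unif_def using J(1,2)
    by (intro CollectI conjI exI[of _ J] exI[of _ "\<lambda>_. Id_on A"]) auto
  moreover have "E = ?E \<inter> Z A L \<times> Z A L"
  proof -
    have "?E \<inter> Z A L \<times> Z A L \<subseteq> E"
    proof (rule subrelI, rule ccontr)
      fix g h assume "(g,h) \<in> ?E \<inter> Z A L \<times> Z A L" "(g,h) \<notin> E"
      then have gh: "g \<in> Z A L" "h \<in> Z A L" "(g,h) \<notin> E" "g \<in> ?P" "h \<in> ?P" "\<forall>j\<in>J. (g j,h j) \<in> Id_on A" by blast+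
      then have "\<forall>j\<in>J. g j = h j" by auto
      then have "(g,h) \<in> E" using gh by (intro subsetD[OF J(3)]) simp
      then show False using gh by blast
    qed
    then show ?thesis using R by blast
  qed
  ultimately show "E \<in> Z_unif A L" unfolding Z_unif_def subspace_unif_def by blast
qed

lemma unif_structure_Z_unif: "unif_structure (Z A L) (Z_unif A L)"
proof (rule unif_structureI)
  show "Z_unif A L \<noteq> {}" using Z_unif_iff[of "Z A L \<times> Z A L" A L] by blast
next
  fix E F assume "E \<in> Z_unif A L" "F \<in> Z_unif A L"
  then obtain J K where "E \<subseteq> Z A L \<times> Z A L" "finite J" "J \<subseteq> univ L"
    "{(g,h). g \<in> Z A L \<and> h \<in> Z A L \<and> (\<forall>j\<in>J. g j = h j)} \<subseteq> E" "finite K" "K \<subseteq> univ L"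
    "{(g,h). g \<in> Z A L \<and> h \<in> Z A L \<and> (\<forall>j\<in>K. g j = h j)} \<subseteq> F" unfolding Z_unif_iff by blast
  then show "E \<inter> F \<in> Z_unif A L" unfolding Z_unif_iff
    by (intro conjI exI[of _ "J \<union> K"]) blast+
next
  fix E assume "E \<in> Z_unif A L"
  then obtain J where J: "E \<subseteq> Z A L \<times> Z A L" "finite J" "J \<subseteq> univ L"
    "{(g,h). g \<in> Z A L \<and> h \<in> Z A L \<and> (\<forall>j\<in>J. g j = h j)} \<subseteq> E" unfolding Z_unif_iff by blast
  show "Id_on (Z A L) \<subseteq> E" "E \<subseteq> Z A L \<times> Z A L" using J by auto
  show "E\<inverse> \<in> Z_unif A L" unfolding Z_unif_iff using J by (intro conjI exI[of _ J]) auto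
  let ?D = "{(g,h). g \<in> Z A L \<and> h \<in> Z A L \<and> (\<forall>j\<in>J. g j = h j)}"
  have "?D \<in> Z_unif A L" unfolding Z_unif_iff using J by (intro conjI exI[of _ J]) auto
  moreover have "?D O ?D \<subseteq> E" using J(4) by auto
  ultimately show "\<exists>D \<in> Z_unif A L. D O D \<subseteq> E" by blast
  fix F assume "E \<subseteq> F" "F \<subseteq> Z A L \<times> Z A L"
  then show "F \<in> Z_unif A L" unfolding Z_unif_iff using J by (intro conjI exI[of _ J]) auto
qed

lemma BA_in_V_Omega: fixes X :: "'b set" and A :: "'a set" assumes U: "unif_structure X U" shows "BA A X U \<in> V_Omega A"
proof -
  let ?B = "BA A X U"
  have e: "eval_trm ?B v t x = eval_trm (Omega A) (\<lambda>i. v i x) t"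
    if "x \<in> X" for v t x
    by (induction t) (use that in \<open>auto simp: BA_def alg_power_def comp_def cong: map_cong\<close>)
  have alg: "is_algebra (Omega_sig A) ?B"
    unfolding is_algebra_def
  proof clarify
    fix s n xs assume s: "(s,n) \<in> Omega_sig A" and xs: "xs \<in> nlists n (univ ?B)"
    have fin: "{(x,x'). x \<in> X \<and> x' \<in> X \<and> (\<forall>f\<in>set ys. (f x, f x') \<in> Id_on A)} \<in> U" 
      if "set ys \<subseteq> univ ?B" for ys using that
    proof (induction ys)
      case Nil
      have "X \<times> X \<in> U" using unif_structure_nonempty[OF U] unif_structure_subset[OF U] unif_structure_mono[OF U] by blast
      moreover have "{(x,x'). x \<in> X \<and> x' \<in> X \<and> (\<forall>f\<in>set []. (f x, f x') \<in> Id_on A)} = X \<times> X" by auto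
      ultimately show ?case by (simp only:)
    next
      case (Cons f ys)
      have "Id_on A \<in> discrete_unif A" by (auto simp: discrete_unif_def)
      then have "{(x,x'). x \<in> X \<and> x' \<in> X \<and> (f x, f x') \<in> Id_on A} \<in> U"
        using Cons.prems unfolding BA_def unif_continuous_def by simp
      then have "{(x,x'). x \<in> X \<and> x' \<in> X \<and> (f x, f x') \<in> Id_on A} \<inter>
        {(x,x'). x \<in> X \<and> x' \<in> X \<and> (\<forall>f\<in>set ys. (f x, f x') \<in> Id_on A)} \<in> U"
        using Cons.IH Cons.prems by (intro unif_structure_Int[OF U]) auto
      moreover have "{(x,x'). x \<in> X \<and> x' \<in> X \<and> (f x, f x') \<in> Id_on A} \<inter>
        {(x,x'). x \<in> X \<and> x' \<in> X \<and> (\<forall>f\<in>set ys. (f x, f x') \<in> Id_on A)} = {(x,x'). x \<in> X \<and> x' \<in> X \<and> (\<forall>f\<in>set (f#ys). (f x, f x') \<in> Id_on A)}"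
        by auto
      ultimately show ?case by (simp only:)
    qed
    have xs': "set xs \<subseteq> univ ?B" "length xs = n" using xs unfolding nlists_def by blast+
    have vals: "set (map (\<lambda>f. f x) xs) \<subseteq> A" if "x \<in> X" for x
    proof -
      have "f x \<in> A" if f: "f \<in> set xs" for f
      proof -
        have "f \<in> univ ?B" using f by (rule subsetD[OF xs'(1)])
        then have "f \<in> X \<rightarrow>\<^sub>E A" by (simp add: BA_def)
        then show ?thesis using \<open>x \<in> X\<close> by (rule PiE_mem)
      qed
      then have "\<forall>f\<in>set xs. f x \<in> A" by (intro ballI)
      then show ?thesis by auto
    qed
    have opA: "opr (Omega A) s ys \<in> A" if "set ys \<subseteq> A" "length ys = n" for ys
    proof -
      have "ys \<in> nlists n A" using that by (rule nlistsI[rotated])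
      from s consider a where "s = ConstSym a" "a \<in> A" | f where "s = FunSym n f" "f \<in> nlists n A \<rightarrow>\<^sub>E A"
        unfolding Omega_sig_def by blast
      then show ?thesis
      proof cases
        case 2
        then have "f ys \<in> A" using \<open>ys \<in> _\<close> by (auto dest: PiE_mem)
        then show ?thesis using 2 by (simp add: Omega_def)
      qed (simp add: Omega_def)
    qed
    let ?g = "opr ?B s xs"
    have g: "?g x = opr (Omega A) s (map (\<lambda>f. f x) xs)" if "x \<in> X" for x
      using that by (simp add: BA_def alg_power_def)
    have gA: "?g \<in> X \<rightarrow>\<^sub>E A"
    proof (rule PiE_I)
      fix x assume x: "x \<in> X"
      show "?g x \<in> A" unfolding g[OF x] using opA[OF vals[OF x]] xs'(2) by simp
    next
      fix x assume "x \<notin> X" then show "?g x = undefined" by (simp add: BA_def alg_power_def)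
    qed
    have "unif_continuous X U A (discrete_unif A) ?g"
      unfolding unif_continuous_def
    proof (intro conjI ballI)
      show "?g \<in> X \<rightarrow> A" using gA by blast
      fix E assume E: "E \<in> discrete_unif A"
      have "{(x,x'). x \<in> X \<and> x' \<in> X \<and> (\<forall>f\<in>set xs. (f x, f x') \<in> Id_on A)}
        \<subseteq> {(x,x'). x \<in> X \<and> x' \<in> X \<and> (?g x, ?g x') \<in> E}"
      proof clarify
        fix x x' assume x: "x \<in> X" "x' \<in> X" "\<forall>f\<in>set xs. (f x, f x') \<in> Id_on A"
        then have "map (\<lambda>f. f x) xs = map (\<lambda>f. f x') xs" by auto
        then have "?g x = ?g x'" using g x by metis
        then show "(?g x, ?g x') \<in> E" using E gA x by (auto simp: discrete_unif_def)
      qed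
      then show "{(x,x'). x \<in> X \<and> x' \<in> X \<and> (?g x, ?g x') \<in> E} \<in> U"
        using unif_structure_mono[OF U fin[OF xs'(1)]] by blast
    qed
    then show "?g \<in> univ ?B" using gA by (simp add: BA_def alg_power_def)
  qed
  have evu: "eval_trm ?B v t \<in> univ ?B" if "t \<in> trms (Omega_sig A)" "range v \<subseteq> univ ?B" for v t
    using that(1)
  proof (induction rule: trms.induct)
    case (2 f n ts)
    then have "map (eval_trm ?B v) ts \<in> nlists n (univ ?B)" by (intro nlistsI) auto
    then show ?case using alg 2(1) unfolding is_algebra_def by fastforce
  qed (use that in auto)
  have "satisfies ?B (s,t)" if "satisfies (Omega A) (s,t)" "s \<in> trms (Omega_sig A)" "t \<in> trms (Omega_sig A)" for s t
    unfolding satisfies_def prod.case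
  proof (intro allI impI)
    fix v :: "nat \<Rightarrow> 'b \<Rightarrow> 'a" assume v: "range v \<subseteq> univ ?B"
    have "eval_trm ?B v s x = eval_trm ?B v t x" if "x \<in> X" for x
    proof -
      have "range (\<lambda>i. v i x) \<subseteq> A"
      proof (rule image_subsetI)
        fix i have "v i \<in> univ ?B" using v by blast
        then have "v i \<in> X \<rightarrow>\<^sub>E A" by (simp add: BA_def)
        then show "v i x \<in> A" using that by (rule PiE_mem)
      qed
      then show ?thesis using \<open>satisfies (Omega A) (s,t)\<close> e[OF that] by (simp add: satisfies_def Omega_def)
    qed
    moreover have "eval_trm ?B v s \<in> X \<rightarrow>\<^sub>E A" "eval_trm ?B v t \<in> X \<rightarrow>\<^sub>E A"
      using evu[OF that(2) v] evu[OF that(3) v] by (auto simp: BA_def)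
    ultimately show "eval_trm ?B v s = eval_trm ?B v t" by (intro PiE_ext)
  qed
  then show ?thesis using alg unfolding V_Omega_def variety_gen_def models_of_def by fast
qed

end

theory Submission
  imports Defs
begin

text \<open>
  A uniformly continuous map on \<open>Z(\<L>)\<close> depends on finitely many coordinates
  \<open>l\<^sub>1, \<dots>, l\<^sub>n\<close>; since every map \<open>g : A\<^sup>n \<rightarrow> A\<close> is an operation of \<open>\<Omega>(A)\<close>, the map is
  \<open>\<rho>(g(l\<^sub>1, \<dots>, l\<^sub>n))\<close> for a suitable \<open>g\<close>.  Since the coordinates of an embedding into a power
  of \<open>\<Omega>(A)\<close> are points of \<open>Z(\<L>)\<close>, injectivity of \<open>\<rho>\<close> means partitionability.

  For density of \<open>\<C>(X)\<close>, let \<open>\<phi> \<in> Z(\<BB>)\<close> and \<open>f\<^sub>1, \<dots>, f\<^sub>n \<in> \<BB>\<close>.  If no \<open>x\<close> satisfied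
  \<open>f\<^sub>i(x) = \<phi>(f\<^sub>i)\<close> for all \<open>i\<close>, then the indicator operation of the point
  \<open>(\<phi>(f\<^sub>1), \<dots>, \<phi>(f\<^sub>n))\<close> would send \<open>(f\<^sub>1, \<dots>, f\<^sub>n)\<close> to a constant map, which contradicts
  that \<open>\<phi>\<close> is a homomorphism.  Total boundedness makes every equivalence relation in \<open>\<U>\<close> the
  kernel of some \<open>f \<in> \<BB>\<close>.  This gives the embedding, and it makes the filter
  generated by the sets \<open>{x. f\<^sub>i(x) = \<phi>(f\<^sub>i) for all i}\<close> Cauchy; its limit is mapped to \<open>\<phi>\<close>.
\<close>

section \<open>Homomorphisms to \<open>\<Omega>(A)\<close>\<close>

lemma Z_mem: "\<phi> \<in> Z A L \<Longrightarrow> l \<in> univ L \<Longrightarrow> \<phi> l \<in> A"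
  by (auto simp: Z_def)

lemma Z_opr:
  "\<phi> \<in> Z A L \<Longrightarrow> (s, n) \<in> Omega_sig A \<Longrightarrow> xs \<in> nlists n (univ L) \<Longrightarrow>
    \<phi> (opr L s xs) = opr (Omega A) s (map \<phi> xs)"
  by (auto simp: Z_def alg_hom_def)

lemma Z_I:
  assumes "\<phi> \<in> univ L \<rightarrow>\<^sub>E A"
    and "\<And>s n xs. (s, n) \<in> Omega_sig A \<Longrightarrow> xs \<in> nlists n (univ L) \<Longrightarrow>
      \<phi> (opr L s xs) = opr (Omega A) s (map \<phi> xs)"
  shows "\<phi> \<in> Z A L"
  using assms by (auto simp: Z_def alg_hom_def Omega_def)

text \<open>Symbols carry extensional functions, so an arbitrary \<open>g\<close> must be restricted
  to \<open>nlists n A\<close> before it names an operation.\<close>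

lemma FunSym_in_Omega_sig:
  assumes "\<And>xs. xs \<in> nlists n A \<Longrightarrow> g xs \<in> A"
  shows "(FunSym n (restrict g (nlists n A)), n) \<in> Omega_sig A"
  using assms by (auto simp: Omega_sig_def)

lemma Z_FunSym:
  assumes "\<phi> \<in> Z A L" "xs \<in> nlists n (univ L)" "\<And>ys. ys \<in> nlists n A \<Longrightarrow> g ys \<in> A"
  shows "\<phi> (opr L (FunSym n (restrict g (nlists n A))) xs) = g (map \<phi> xs)"
proof -
  have "map \<phi> xs \<in> nlists n A"
    using nlistsE_set[OF assms(2)] nlistsE_length[OF assms(2)] Z_mem[OF assms(1)]
    by (intro nlistsI) auto
  then show ?thesis
    using Z_opr[OF assms(1) FunSym_in_Omega_sig assms(2), of g] assms(3)
    by (simp add: Omega_def)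
qed

lemma V_Omega_opr_closed:
  assumes "L \<in> V_Omega A" "(s, n) \<in> Omega_sig A" "xs \<in> nlists n (univ L)"
  shows "opr L s xs \<in> univ L"
  using assms by (auto simp: V_Omega_def variety_gen_def is_algebra_def)


section \<open>Uniformly continuous maps to \<open>A\<close>\<close>

lemma opr_BA: "x \<in> X \<Longrightarrow> opr (BA A X U) s fs x = opr (Omega A) s (map (\<lambda>f. f x) fs)"
  by (simp add: BA_def alg_power_def)

lemma univ_BA_mem: "f \<in> univ (BA A X U) \<Longrightarrow> x \<in> X \<Longrightarrow> f x \<in> A"
  by (auto simp: BA_def)

text \<open>The diagonal is the least entourage of the discrete uniformity, so uniform continuity
  into \<open>A\<close> can be tested on it alone, and its preimage is the kernel of
  \<open>f\<close>.\<close>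

lemma univ_BA_iff:
  assumes U: "unif_structure X U"
  shows "f \<in> univ (BA A X U) \<longleftrightarrow>
    f \<in> X \<rightarrow>\<^sub>E A \<and> {(x, y). x \<in> X \<and> y \<in> X \<and> f x = f y} \<in> U"
proof -
  have "(\<forall>E \<in> discrete_unif A. {(x, y). x \<in> X \<and> y \<in> X \<and> (f x, f y) \<in> E} \<in> U) \<longleftrightarrow>
      {(x, y). x \<in> X \<and> y \<in> X \<and> f x = f y} \<in> U" if f: "f \<in> X \<rightarrow>\<^sub>E A"
  proof
    assume *: "\<forall>E \<in> discrete_unif A. {(x, y). x \<in> X \<and> y \<in> X \<and> (f x, f y) \<in> E} \<in> U"
    have "Id_on A \<in> discrete_unif A"
      by (auto simp: discrete_unif_def)
    moreover have "{(x, y). x \<in> X \<and> y \<in> X \<and> (f x, f y) \<in> Id_on A} =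
        {(x, y). x \<in> X \<and> y \<in> X \<and> f x = f y}"
      using f by auto
    ultimately show "{(x, y). x \<in> X \<and> y \<in> X \<and> f x = f y} \<in> U"
      using * by force
  next
    assume *: "{(x, y). x \<in> X \<and> y \<in> X \<and> f x = f y} \<in> U"
    show "\<forall>E \<in> discrete_unif A. {(x, y). x \<in> X \<and> y \<in> X \<and> (f x, f y) \<in> E} \<in> U"
    proof (intro ballI unif_structure_mono[OF U *])
      fix E assume "E \<in> discrete_unif A"
      then show "{(x, y). x \<in> X \<and> y \<in> X \<and> f x = f y} \<subseteq>
          {(x, y). x \<in> X \<and> y \<in> X \<and> (f x, f y) \<in> E}"
        using f by (fastforce simp: discrete_unif_def)
    qed auto
  qed
  then show ?thesis
    by (auto simp: BA_def unif_continuous_def)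
qed

lemma unif_structure_Inter_kernels:
  assumes U: "unif_structure X U" and "finite J" "J \<subseteq> univ (BA A X U)"
  shows "{(x, y). x \<in> X \<and> y \<in> X \<and> (\<forall>f \<in> J. f x = f y)} \<in> U"
  using assms(2,3)
proof (induction J)
  case empty
  obtain E where "E \<in> U"
    using unif_structure_nonempty[OF U] by blast
  then have "X \<times> X \<in> U"
    using unif_structure_mono[OF U] unif_structure_subset[OF U] by blast
  moreover have "{(x, y). x \<in> X \<and> y \<in> X} = X \<times> X"
    by auto
  ultimately show ?case
    by simp
next
  case (insert f J)
  then have "{(x, y). x \<in> X \<and> y \<in> X \<and> f x = f y} \<inter>
      {(x, y). x \<in> X \<and> y \<in> X \<and> (\<forall>f \<in> J. f x = f y)} \<in> U"
    by (intro unif_structure_Int[OF U]) (auto simp: univ_BA_iff[OF U])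
  moreover have "{(x, y). x \<in> X \<and> y \<in> X \<and> f x = f y} \<inter>
      {(x, y). x \<in> X \<and> y \<in> X \<and> (\<forall>f \<in> J. f x = f y)} =
      {(x, y). x \<in> X \<and> y \<in> X \<and> (\<forall>f \<in> insert f J. f x = f y)}"
    by auto
  ultimately show ?case
    by simp
qed

text \<open>A map that factors through \<open>X // R\<close> has a kernel containing
  \<open>R\<close>. The labelling \<open>g\<close> of the blocks is left free: below it is
  two-valued in one use and injective in the other.\<close>

lemma equiv_kernel_in_BA:
  assumes U: "unif_structure X U" and R: "R \<in> U" "equiv X R"
    and g: "g \<in> X // R \<rightarrow> A"
  shows "(\<lambda>x\<in>X. g (R `` {x})) \<in> univ (BA A X U)"
  unfolding univ_BA_iff[OF U]
proof
  show "(\<lambda>x\<in>X. g (R `` {x})) \<in> X \<rightarrow>\<^sub>E A"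
    using g by (auto simp: quotient_def)
  have "R \<subseteq> X \<times> X"
    using unif_structure_subset[OF U R(1)] .
  then show "{(x, y). x \<in> X \<and> y \<in> X \<and>
      (\<lambda>x\<in>X. g (R `` {x})) x = (\<lambda>x\<in>X. g (R `` {x})) y} \<in> U"
    using equiv_class_eq[OF R(2)]
    by (intro unif_structure_mono[OF U R(1)]) auto
qed

section \<open>Separating points, and maps with a prescribed kernel\<close>

lemma infinite_obtain_two:
  assumes "infinite A"
  obtains a b where "a \<in> A" "b \<in> A" "a \<noteq> b"
proof -
  obtain a where "a \<in> A"
    using infinite_imp_nonempty[OF assms] by blast
  moreover obtain b where "b \<in> A - {a}"
    using infinite_imp_nonempty[OF infinite_remove[OF assms, of a]] by blast
  ultimately show ?thesis
    using that by blast
qed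

lemma separating_map:
  assumes U: "unif_structure X U" and R: "R \<in> U" "equiv X R" "(x, y) \<notin> R"
    and xy: "x \<in> X" "y \<in> X" and A: "infinite A"
  obtains f where "f \<in> univ (BA A X U)" "f x \<noteq> f y"
proof -
  obtain a b where ab: "a \<in> A" "b \<in> A" "a \<noteq> b"
    using A by (rule infinite_obtain_two)
  \<comment> \<open>The indicator of the block of \<open>x\<close>, with \<open>a\<close> and
    \<open>b\<close> as truth values.\<close>
  define g where "g C = (if C = R `` {x} then a else b)" for C
  have "R `` {x} \<noteq> R `` {y}"
    using eq_equiv_class[OF _ R(2)] R(3) xy by blast
  then have "(\<lambda>x\<in>X. g (R `` {x})) x \<noteq> (\<lambda>x\<in>X. g (R `` {x})) y"
    using ab xy by (auto simp: g_def)
  moreover have "(\<lambda>x\<in>X. g (R `` {x})) \<in> univ (BA A X U)"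
    by (rule equiv_kernel_in_BA[OF U R(1,2)]) (use ab in \<open>auto simp: g_def\<close>)
  ultimately show ?thesis
    using that by blast
qed

text \<open>Fewer than |A|^+ blocks means at most |A| blocks, so they can be labelled injectively by
  elements of \<open>A\<close>; the label of its block then determines a point up to
  \<open>R\<close>.\<close>

lemma exact_kernel_map:
  assumes U: "unif_structure X U" and R: "R \<in> U" "equiv X R"
    and tb: "card_totally_bounded (cardSuc |A| ) X U"
  obtains f where "f \<in> univ (BA A X U)"
    "{(x, y). x \<in> X \<and> y \<in> X \<and> f x = f y} \<subseteq> R"
proof -
  have "|X // R| <o cardSuc |A|"
    using tb R by (auto simp: card_totally_bounded_def)
  then have "|X // R| \<le>o |A|"
    by (rule cardSuc_ordLeq_ordLess[OF card_of_Card_order card_of_Card_order, THEN iffD1])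
  then obtain g where g: "inj_on g (X // R)" "g ` (X // R) \<subseteq> A"
    using card_of_ordLeq[of "X // R" A] by blast
  have "(x, y) \<in> R" if "x \<in> X" "y \<in> X"
    "(\<lambda>x\<in>X. g (R `` {x})) x = (\<lambda>x\<in>X. g (R `` {x})) y" for x y
  proof -
    have "R `` {x} = R `` {y}"
      using that g(1) by (auto dest!: inj_onD intro: quotientI)
    then show ?thesis
      using eq_equiv_class[OF _ R(2)] that by blast
  qed
  then have "{(x, y). x \<in> X \<and> y \<in> X \<and>
      (\<lambda>x\<in>X. g (R `` {x})) x = (\<lambda>x\<in>X. g (R `` {x})) y} \<subseteq> R"
    by blast
  moreover have "(\<lambda>x\<in>X. g (R `` {x})) \<in> univ (BA A X U)"
    by (rule equiv_kernel_in_BA[OF U R]) (use g(2) in blast)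
  ultimately show ?thesis
    using that by blast
qed


section \<open>The map \<open>\<rho>\<close>\<close>

text \<open>The kernel of \<open>rho A L l\<close> is the basic entourage of Z(L) given by the
  single coordinate \<open>l\<close>.\<close>

lemma rho_in_BA:
  assumes "l \<in> univ L"
  shows "rho A L l \<in> univ (BA A (Z A L) (Z_unif A L))"
  unfolding univ_BA_iff[OF unif_structure_Z_unif] Z_unif_iff
  using assms by (auto simp: rho_def Z_mem intro!: exI[of _ "{l}"])

lemma alg_hom_rho:
  assumes L: "L \<in> V_Omega A"
  shows "alg_hom (Omega_sig A) L (BA A (Z A L) (Z_unif A L)) (rho A L)"
proof -
  have "rho A L (opr L s xs) = opr (BA A (Z A L) (Z_unif A L)) s (map (rho A L) xs)"
    if "(s, n) \<in> Omega_sig A" "xs \<in> nlists n (univ L)" for s n xs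
  proof
    fix \<phi>
    show "rho A L (opr L s xs) \<phi> = opr (BA A (Z A L) (Z_unif A L)) s (map (rho A L) xs) \<phi>"
    proof (cases "\<phi> \<in> Z A L")
      case True
      then have "rho A L (opr L s xs) \<phi> = opr (Omega A) s (map \<phi> xs)"
        using Z_opr[OF _ that] by (simp add: rho_def)
      also have "map \<phi> xs = map (\<lambda>f. f \<phi>) (map (rho A L) xs)"
        using True by (simp add: rho_def)
      finally show ?thesis
        using True by (simp only: opr_BA)
    qed (simp add: rho_def BA_def alg_power_def)
  qed
  then show ?thesis
    using rho_in_BA by (fastforce simp: alg_hom_def)
qed

lemma rho_surj:
  assumes L: "L \<in> V_Omega A" and A: "infinite A"
  shows "rho A L ` univ L = univ (BA A (Z A L) (Z_unif A L))"
proof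
  show "rho A L ` univ L \<subseteq> univ (BA A (Z A L) (Z_unif A L))"
    using rho_in_BA by (rule image_subsetI)
  show "univ (BA A (Z A L) (Z_unif A L)) \<subseteq> rho A L ` univ L"
  proof
    fix f assume "f \<in> univ (BA A (Z A L) (Z_unif A L))"
    then have f: "f \<in> Z A L \<rightarrow>\<^sub>E A"
      and ker: "{(\<phi>, \<psi>). \<phi> \<in> Z A L \<and> \<psi> \<in> Z A L \<and> f \<phi> = f \<psi>} \<in> Z_unif A L"
      by (simp_all add: univ_BA_iff[OF unif_structure_Z_unif])
    obtain J where J: "finite J" "J \<subseteq> univ L"
      "{(g, h). g \<in> Z A L \<and> h \<in> Z A L \<and> (\<forall>j\<in>J. g j = h j)} \<subseteq>
        {(\<phi>, \<psi>). \<phi> \<in> Z A L \<and> \<psi> \<in> Z A L \<and> f \<phi> = f \<psi>}"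
      using ker unfolding Z_unif_iff by blast
    obtain ls where ls: "set ls = J"
      using finite_list[OF J(1)] by blast
    obtain a where a: "a \<in> A"
      using infinite_imp_nonempty[OF A] by blast
    \<comment> \<open>\<open>g\<close> recovers the value of \<open>f\<close> from the values of a
      homomorphism at \<open>ls\<close>. Tuples that no homomorphism attains get the default
      \<open>a\<close>, which keeps \<open>g\<close> a total operation on \<open>A\<close>.\<close>
    define g where "g ys = (if \<exists>\<phi> \<in> Z A L. map \<phi> ls = ys
        then f (SOME \<phi>. \<phi> \<in> Z A L \<and> map \<phi> ls = ys) else a)" for ys
    \<comment> \<open>The choice made by \<open>SOME\<close> is harmless: homomorphisms that agree
      on \<open>J\<close> have the same value under \<open>f\<close>.\<close>
    have g_eq: "g (map \<phi> ls) = f \<phi>" if "\<phi> \<in> Z A L" for \<phi>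
    proof -
      define \<psi> where "\<psi> = (SOME \<psi>. \<psi> \<in> Z A L \<and> map \<psi> ls = map \<phi> ls)"
      have "g (map \<phi> ls) = f \<psi>"
        unfolding g_def \<psi>_def using that by (intro if_P bexI[of _ \<phi>] refl)
      moreover have "\<psi> \<in> Z A L \<and> map \<psi> ls = map \<phi> ls"
        unfolding \<psi>_def using that
        by (rule someI[of "\<lambda>\<psi>. \<psi> \<in> Z A L \<and> map \<psi> ls = map \<phi> ls", OF conjI[OF _ refl]])
      then have "\<psi> \<in> Z A L" "\<forall>j\<in>J. \<psi> j = \<phi> j"
        unfolding ls[symmetric] by simp_all
      then have "(\<psi>, \<phi>) \<in> {(g, h). g \<in> Z A L \<and> h \<in> Z A L \<and> (\<forall>j\<in>J. g j = h j)}"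
        using that by simp
      then have "f \<psi> = f \<phi>"
        using J(3) by blast
      ultimately show ?thesis
        by simp
    qed
    have gA: "g ys \<in> A" for ys
    proof (cases "\<exists>\<phi> \<in> Z A L. map \<phi> ls = ys")
      case True
      then show ?thesis
        using g_eq f by auto
    qed (simp add: g_def a)
    define s where "s = FunSym (length ls) (restrict g (nlists (length ls) A))"
    have lsL: "ls \<in> nlists (length ls) (univ L)"
      using ls J(2) by (intro nlistsI) auto
    have "opr L s ls \<in> univ L"
      unfolding s_def using V_Omega_opr_closed[OF L FunSym_in_Omega_sig lsL] gA by blast
    moreover have "f = rho A L (opr L s ls)"
    proof
      fix \<phi>
      show "f \<phi> = rho A L (opr L s ls) \<phi>"
        using f Z_FunSym[OF _ lsL, of \<phi> A g] gA g_eq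
        by (cases "\<phi> \<in> Z A L") (auto simp: rho_def s_def)
    qed
    ultimately show "f \<in> rho A L ` univ L"
      by blast
  qed
qed

text \<open>The index set Z(L) already has the type that \<open>partitionable\<close> asks for, so
  \<rho> itself can serve as the embedding. Conversely, \<rho>(l) records the value of every
  homomorphism at l, hence all coordinates of \<open>h l\<close>.\<close>

lemma inj_on_rho_iff_partitionable:
  assumes L: "L \<in> V_Omega A"
  shows "inj_on (rho A L) (univ L) \<longleftrightarrow> partitionable A L"
proof
  assume inj: "inj_on (rho A L) (univ L)"
  have "alg_hom (Omega_sig A) L (alg_power (Omega A) (Z A L)) (rho A L)"
    using alg_hom_rho[OF L] unfolding alg_hom_def
    by (auto simp: BA_def alg_power_def Omega_def)
  then show "partitionable A L"
    using inj unfolding partitionable_def embeds_in_power_def by blast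
next
  assume "partitionable A L"
  then obtain I :: "('b \<Rightarrow> 'a) set" and h
    where h: "alg_hom (Omega_sig A) L (alg_power (Omega A) I) h" and inj: "inj_on h (univ L)"
    by (auto simp: partitionable_def embeds_in_power_def)
  have hA: "h l \<in> I \<rightarrow>\<^sub>E A" if "l \<in> univ L" for l
    using h that by (auto simp: alg_hom_def alg_power_def Omega_def)
  have coord: "(\<lambda>l\<in>univ L. h l i) \<in> Z A L" if i: "i \<in> I" for i
  proof (rule Z_I)
    show "(\<lambda>l\<in>univ L. h l i) \<in> univ L \<rightarrow>\<^sub>E A"
      using hA i by auto
    fix s n xs assume s: "(s, n) \<in> Omega_sig A" and xs: "xs \<in> nlists n (univ L)"
    have "h (opr L s xs) = opr (alg_power (Omega A) I) s (map h xs)"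
      using h s xs by (auto simp: alg_hom_def)
    then have "h (opr L s xs) i = opr (Omega A) s (map (\<lambda>l. h l i) xs)"
      using i by (simp add: alg_power_def comp_def)
    \<comment> \<open>Points of Z(L) are extensional, hence the restricted coordinate; on arguments
      from the carrier the restriction is invisible.\<close>
    moreover have "map (\<lambda>l. h l i) xs = map (\<lambda>l\<in>univ L. h l i) xs"
      using nlistsE_set[OF xs] by auto
    ultimately show "(\<lambda>l\<in>univ L. h l i) (opr L s xs) =
        opr (Omega A) s (map (\<lambda>l\<in>univ L. h l i) xs)"
      using V_Omega_opr_closed[OF L s xs] by simp
  qed
  show "inj_on (rho A L) (univ L)"
  proof (rule inj_onI)
    fix l m assume lm: "l \<in> univ L" "m \<in> univ L" "rho A L l = rho A L m"
    have "h l i = h m i" if "i \<in> I" for i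
      using fun_cong[OF lm(3), of "\<lambda>l\<in>univ L. h l i"] coord[OF that] lm(1,2)
      by (simp add: rho_def)
    then have "h l = h m"
      by (intro PiE_ext[OF hA[OF lm(1)] hA[OF lm(2)]])
    then show "l = m"
      using inj_onD[OF inj _ lm(1,2)] by blast
  qed
qed


section \<open>The map \<open>\<C>\<close>\<close>

lemma canon_in_Z:
  assumes U: "unif_structure X U" and x: "x \<in> X"
  shows "canon A X U x \<in> Z A (BA A X U)"
proof (rule Z_I)
  show "canon A X U x \<in> univ (BA A X U) \<rightarrow>\<^sub>E A"
    using x univ_BA_mem by (auto simp: canon_def)
  fix s n fs assume s: "(s, n) \<in> Omega_sig A" and fs: "fs \<in> nlists n (univ (BA A X U))"
  \<comment> \<open>Evaluation is cut off outside the carrier, so closure of the carrier under the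
    operations is needed here.\<close>
  have "canon A X U x (opr (BA A X U) s fs) = opr (BA A X U) s fs x"
    using V_Omega_opr_closed[OF BA_in_V_Omega[OF U] s fs] by (simp add: canon_def)
  also have "\<dots> = opr (Omega A) s (map (\<lambda>f. f x) fs)"
    by (rule opr_BA[OF x])
  also have "map (\<lambda>f. f x) fs = map (canon A X U x) fs"
    using nlistsE_set[OF fs] by (auto simp: canon_def)
  finally show "canon A X U x (opr (BA A X U) s fs) =
      opr (Omega A) s (map (canon A X U x) fs)" .
qed

text \<open>The preimage of the basic entourage given by a finite \<open>J\<close> contains the
  intersection of the kernels of the members of \<open>J\<close>.\<close>

lemma unif_continuous_canon:
  assumes U: "unif_structure X U"
  shows "unif_continuous X U (Z A (BA A X U)) (Z_unif A (BA A X U)) (canon A X U)"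
  unfolding unif_continuous_def
proof (intro conjI ballI)
  show "canon A X U \<in> X \<rightarrow> Z A (BA A X U)"
    using canon_in_Z[OF U] by blast
  fix E assume "E \<in> Z_unif A (BA A X U)"
  then obtain J where J: "finite J" "J \<subseteq> univ (BA A X U)"
    "{(g, h). g \<in> Z A (BA A X U) \<and> h \<in> Z A (BA A X U) \<and> (\<forall>j\<in>J. g j = h j)} \<subseteq> E"
    unfolding Z_unif_iff by blast
  show "{(x, x'). x \<in> X \<and> x' \<in> X \<and> (canon A X U x, canon A X U x') \<in> E} \<in> U"
  proof (rule unif_structure_mono[OF U unif_structure_Inter_kernels[OF U J(1,2)]])
    show "{(x, y). x \<in> X \<and> y \<in> X \<and> (\<forall>f\<in>J. f x = f y)} \<subseteq>
        {(x, x'). x \<in> X \<and> x' \<in> X \<and> (canon A X U x, canon A X U x') \<in> E}"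
    proof clarify
      fix x y assume xy: "x \<in> X" "y \<in> X" "\<forall>f\<in>J. f x = f y"
      then show "(canon A X U x, canon A X U y) \<in> E"
        using J(2) by (intro subsetD[OF J(3)]) (auto simp: canon_in_Z[OF U], auto simp: canon_def)
    qed
  qed auto
qed

text \<open>On finitely many maps every homomorphism looks like evaluation at a point. This yields
  density, and later the nonempty sets that generate a Cauchy filter.\<close>

lemma Z_BA_finite_realization:
  assumes U: "unif_structure X U" and A: "infinite A"
    and \<phi>: "\<phi> \<in> Z A (BA A X U)" and J: "finite J" "J \<subseteq> univ (BA A X U)"
  obtains x where "x \<in> X" "\<And>f. f \<in> J \<Longrightarrow> f x = \<phi> f"
proof -
  obtain a b where ab: "a \<in> A" "b \<in> A" "a \<noteq> b"
    using A by (rule infinite_obtain_two)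
  obtain fs where fs: "set fs = J"
    using finite_list[OF J(1)] by blast
  define g where "g ys = (if ys = map \<phi> fs then a else b)" for ys
  have gA: "g ys \<in> A" for ys
    using ab by (simp add: g_def)
  define s where "s = FunSym (length fs) (restrict g (nlists (length fs) A))"
  have fsB: "fs \<in> nlists (length fs) (univ (BA A X U))"
    using fs J(2) by (intro nlistsI) auto
  have \<phi>_s: "\<phi> (opr (BA A X U) s fs) = a"
    unfolding s_def using Z_FunSym[OF \<phi> fsB] gA by (simp add: g_def)
  have s_at: "opr (BA A X U) s fs x = g (map (\<lambda>f. f x) fs)" if x: "x \<in> X" for x
  proof -
    have "map (\<lambda>f. f x) fs \<in> nlists (length fs) A"
      using fs J(2) univ_BA_mem[OF _ x] by (intro nlistsI) auto
    then show ?thesis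
      by (simp add: opr_BA[OF x] s_def Omega_def)
  qed
  have b_sig: "(ConstSym b, 0) \<in> Omega_sig A"
    using ab by (auto simp: Omega_sig_def)
  have "\<exists>x\<in>X. map (\<lambda>f. f x) fs = map \<phi> fs"
  proof (rule ccontr)
    assume none: "\<not> (\<exists>x\<in>X. map (\<lambda>f. f x) fs = map \<phi> fs)"
    \<comment> \<open>The indicator never takes the value \<open>a\<close> on \<open>X\<close>, so
      it is the constant \<open>b\<close>. If \<open>X\<close> is empty, both sides are the
      everywhere undefined map, so this case is refuted as well, also for empty
      \<open>J\<close>.\<close>
    have "opr (BA A X U) s fs = opr (BA A X U) (ConstSym b) []"
    proof
      fix x
      show "opr (BA A X U) s fs x = opr (BA A X U) (ConstSym b) [] x"
      proof (cases "x \<in> X")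
        case True
        then show ?thesis
          using none s_at by (auto simp: opr_BA g_def) (simp add: Omega_def)
      qed (simp add: BA_def alg_power_def)
    qed
    then have "\<phi> (opr (BA A X U) s fs) = b"
      using Z_opr[OF \<phi> b_sig, of "[]"] by (simp add: Omega_def nlists_n_0)
    then show False
      using \<phi>_s ab by simp
  qed
  then show ?thesis
    using that fs by auto
qed

text \<open>A basic neighbourhood of \<phi> prescribes only finitely many of its values.\<close>

lemma canon_dense:
  assumes U: "unif_structure X U" and A: "infinite A"
  shows "unif_topology (Z A (BA A X U)) (Z_unif A (BA A X U)) closure_of (canon A X U ` X) =
    Z A (BA A X U)"
proof
  let ?B = "BA A X U"
  let ?T = "unif_topology (Z A ?B) (Z_unif A ?B)"
  have top: "topspace ?T = Z A ?B"
    by (rule topspace_unif_topology[OF unif_structure_Z_unif])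
  show "?T closure_of (canon A X U ` X) \<subseteq> Z A ?B"
    using closure_of_subset_topspace[of ?T] top by simp
  show "Z A ?B \<subseteq> ?T closure_of (canon A X U ` X)"
  proof
    fix \<phi> assume \<phi>: "\<phi> \<in> Z A ?B"
    have "\<exists>y\<in>canon A X U ` X. y \<in> G" if G: "\<phi> \<in> G" "openin ?T G" for G
    proof -
      obtain E where E: "E \<in> Z_unif A ?B" "E `` {\<phi>} \<subseteq> G"
        using G by (auto simp: openin_unif_topology[OF unif_structure_Z_unif])
      obtain J where J: "finite J" "J \<subseteq> univ ?B"
        "{(g, h). g \<in> Z A ?B \<and> h \<in> Z A ?B \<and> (\<forall>j\<in>J. g j = h j)} \<subseteq> E"
        using E(1) unfolding Z_unif_iff by blast
      obtain x where x: "x \<in> X" "\<And>f. f \<in> J \<Longrightarrow> f x = \<phi> f"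
        using Z_BA_finite_realization[OF U A \<phi> J(1,2)] by blast
      have "(\<phi>, canon A X U x) \<in> E"
        by (intro subsetD[OF J(3)])
          (use \<phi> x J(2) canon_in_Z[OF U x(1)] in \<open>auto simp: canon_def\<close>)
      then show ?thesis
        using E(2) x(1) by blast
    qed
    then show "\<phi> \<in> ?T closure_of (canon A X U ` X)"
      using \<phi> top by (simp add: in_closure_of)
  qed
qed

section \<open>Injectivity and embedding\<close>

lemma inj_on_canon:
  assumes U: "unif_structure X U" and A: "infinite A"
    and sep: "unif_separated X U" and na: "non_archimedean X U"
  shows "inj_on (canon A X U) X"
proof (rule inj_onI, rule ccontr)
  fix x y assume xy: "x \<in> X" "y \<in> X" "canon A X U x = canon A X U y" "x \<noteq> y"
  have "(x, y) \<notin> \<Inter>U"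
    using sep xy by (auto simp: unif_separated_def)
  \<comment> \<open>Some entourage misses the pair, and so does any equivalence relation inside
    it.\<close>
  then obtain R where R: "R \<in> U" "equiv X R" "(x, y) \<notin> R"
    using na unfolding non_archimedean_def by blast
  obtain f where f: "f \<in> univ (BA A X U)" "f x \<noteq> f y"
    using separating_map[OF U R xy(1,2) A] .
  then show False
    using fun_cong[OF xy(3), of f] by (simp add: canon_def)
qed

lemma unif_embedding_canon:
  assumes U: "unif_structure X U" and A: "infinite A"
    and sep: "unif_separated X U" and na: "non_archimedean X U"
    and tb: "card_totally_bounded (cardSuc |A| ) X U"
  shows "unif_embedding X U (Z A (BA A X U)) (Z_unif A (BA A X U)) (canon A X U)"
proof -
  let ?B = "BA A X U"
  let ?C = "canon A X U"
  let ?V = "subspace_unif (?C ` X) (Z_unif A ?B)"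
  have inj: "inj_on ?C X"
    using inj_on_canon[OF U A sep na] .
  have CZ: "?C \<in> X \<rightarrow> Z A ?B"
    using canon_in_Z[OF U] by blast
  have "{(x, x'). x \<in> X \<and> x' \<in> X \<and> (?C x, ?C x') \<in> E} \<in> U" if "E \<in> ?V" for E
  proof -
    obtain E' where E': "E' \<in> Z_unif A ?B" "E = E' \<inter> ?C ` X \<times> ?C ` X"
      using \<open>E \<in> ?V\<close> unfolding subspace_unif_def by blast
    have "{(x, x'). x \<in> X \<and> x' \<in> X \<and> (?C x, ?C x') \<in> E} =
        {(x, x'). x \<in> X \<and> x' \<in> X \<and> (?C x, ?C x') \<in> E'}"
      using E'(2) by auto
    then show ?thesis
      using unif_continuous_canon[OF U, of A] E'(1) by (simp add: unif_continuous_def)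
  qed
  then have cont: "unif_continuous X U (?C ` X) ?V ?C"
    by (simp add: unif_continuous_def)
  have "{(p, q). p \<in> ?C ` X \<and> q \<in> ?C ` X \<and> (inv_into X ?C p, inv_into X ?C q) \<in> E} \<in> ?V"
    if "E \<in> U" for E
  proof -
    obtain R where R: "R \<in> U" "equiv X R" "R \<subseteq> E"
      using na \<open>E \<in> U\<close> unfolding non_archimedean_def by blast
    \<comment> \<open>One coordinate \<open>f\<close> controls the whole entourage: points with
      equal \<open>f\<close>-value are \<open>R\<close>-related, hence
      \<open>E\<close>-related.\<close>
    obtain f where f: "f \<in> univ ?B"
      "{(x, y). x \<in> X \<and> y \<in> X \<and> f x = f y} \<subseteq> R"
      using exact_kernel_map[OF U R(1,2) tb] .
    let ?F = "{(p, q). p \<in> ?C ` X \<and> q \<in> ?C ` X \<and>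
      (inv_into X ?C p, inv_into X ?C q) \<in> E}"
    let ?K = "{(g, h). g \<in> Z A ?B \<and> h \<in> Z A ?B \<and> g f = h f}"
    \<comment> \<open>Entourages of the image are exact traces. \<open>?K\<close> traces to a subset
      of \<open>?F\<close>, and adding \<open>?F\<close> makes the trace equal to
      \<open>?F\<close>.\<close>
    have KF: "?K \<union> ?F \<in> Z_unif A ?B"
      unfolding Z_unif_iff
    proof (intro conjI exI[of _ "{f}"])
      show "?K \<union> ?F \<subseteq> Z A ?B \<times> Z A ?B"
        using CZ by blast
    qed (use f(1) in auto)
    have "?K \<inter> ?C ` X \<times> ?C ` X \<subseteq> ?F"
    proof clarify
      fix x y assume xy: "x \<in> X" "y \<in> X" "?C x f = ?C y f"
      then have "f x = f y"
        using f(1) by (simp add: canon_def)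
      then have "(x, y) \<in> E"
        using f(2) xy R(3) by blast
      then show "?C x \<in> ?C ` X \<and> ?C y \<in> ?C ` X \<and>
          (inv_into X ?C (?C x), inv_into X ?C (?C y)) \<in> E"
        using xy inj by (simp add: inv_into_f_f)
    qed
    moreover have "?F \<subseteq> ?C ` X \<times> ?C ` X"
      by blast
    ultimately have F_eq: "?F = (?K \<union> ?F) \<inter> ?C ` X \<times> ?C ` X"
      by (simp only: Int_Un_distrib2 Int_absorb2 Un_absorb1)
    show ?thesis
      unfolding subspace_unif_def by (intro CollectI exI conjI, rule F_eq, rule KF)
  qed
  then have "unif_continuous (?C ` X) ?V X U (inv_into X ?C)"
    by (auto simp: unif_continuous_def inv_into_into)
  then show ?thesis
    using inj cont CZ by (simp add: unif_embedding_def unif_iso_def bij_betw_def)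
qed

section \<open>Surjectivity for complete spaces\<close>

lemma canon_surj:
  assumes U: "unif_structure X U" and A: "infinite A"
    and compl: "unif_complete X U" and na: "non_archimedean X U"
    and tb: "card_totally_bounded (cardSuc |A| ) X U"
  shows "canon A X U ` X = Z A (BA A X U)"
proof
  let ?B = "BA A X U"
  show "canon A X U ` X \<subseteq> Z A ?B"
    using canon_in_Z[OF U] by blast
  show "Z A ?B \<subseteq> canon A X U ` X"
  proof
    fix \<phi> assume \<phi>: "\<phi> \<in> Z A ?B"
    \<comment> \<open>\<open>S J\<close> collects the points whose evaluation agrees with \<phi> on
      \<open>J\<close>. These sets are directed, since \<open>S (J \<union> K)\<close> lies in both
      \<open>S J\<close> and \<open>S K\<close>.\<close>
    define S where "S J = {x \<in> X. \<forall>f\<in>J. f x = \<phi> f}" for J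
    define \<J> where "\<J> = {J. finite J \<and> J \<subseteq> univ ?B}"
    define F where "F = (INF J\<in>\<J>. principal (S J))"
    have ev_iff: "eventually P F \<longleftrightarrow> (\<exists>J\<in>\<J>. eventually P (principal (S J)))" for P
      unfolding F_def
    proof (rule eventually_INF_base)
      show "\<J> \<noteq> {}"
        by (auto simp: \<J>_def)
      fix J K assume "J \<in> \<J>" "K \<in> \<J>"
      then show "\<exists>M\<in>\<J>. principal (S M) \<le> inf (principal (S J)) (principal (S K))"
        by (intro bexI[of _ "J \<union> K"]) (auto simp: \<J>_def S_def)
    qed
    have ev_S: "eventually (\<lambda>x. x \<in> S J) F" if "J \<in> \<J>" for J
      using that by (auto simp: ev_iff eventually_principal)
    have S_ne: "S J \<noteq> {}" if J: "J \<in> \<J>" for J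
    proof -
      obtain x where "x \<in> X" "\<And>f. f \<in> J \<Longrightarrow> f x = \<phi> f"
        using Z_BA_finite_realization[OF U A \<phi>, of J] J by (auto simp: \<J>_def)
      then show ?thesis
        by (auto simp: S_def)
    qed
    have F_bot: "F \<noteq> bot"
      using S_ne by (auto simp: trivial_limit_def ev_iff eventually_principal)
    have "unif_cauchy_filter X U F"
      unfolding unif_cauchy_filter_def
    proof (intro conjI ballI)
      show "F \<noteq> bot"
        by (rule F_bot)
      have "eventually (\<lambda>x. x \<in> X) F"
        using ev_S[of "{}"] by (simp add: S_def \<J>_def)
      then show "F \<le> principal X"
        by (simp add: le_principal)
      fix E assume "E \<in> U"
      then obtain R where R: "R \<in> U" "equiv X R" "R \<subseteq> E"
        using na unfolding non_archimedean_def by blast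
      obtain f where f: "f \<in> univ ?B"
        "{(x, y). x \<in> X \<and> y \<in> X \<and> f x = f y} \<subseteq> R"
        using exact_kernel_map[OF U R(1,2) tb] .
      \<comment> \<open>On \<open>S {f}\<close> the map \<open>f\<close> is constant with value
        \<open>\<phi> f\<close>, so this set is \<open>R\<close>-small.\<close>
      have "S {f} \<times> S {f} \<subseteq> E"
        using f(2) R(3) by (auto simp: S_def)
      then show "\<exists>S. eventually (\<lambda>x. x \<in> S) F \<and> S \<times> S \<subseteq> E"
        using ev_S[of "{f}"] f(1) by (auto simp: \<J>_def)
    qed
    then obtain x where lim: "limitin (unif_topology X U) (\<lambda>y. y) x F"
      using compl by (auto simp: unif_complete_def)
    then have x: "x \<in> X"
      by (simp add: limitin_def topspace_unif_topology[OF U])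
    have "f x = \<phi> f" if f: "f \<in> univ ?B" for f
    proof -
      \<comment> \<open>The level set of \<open>f\<close> through the limit is open, so it belongs
        to the filter and meets \<open>S {f}\<close>; a common point gives
        \<open>f x = \<phi> f\<close>.\<close>
      let ?N = "{y \<in> X. f y = f x}"
      have "openin (unif_topology X U) ?N"
        unfolding openin_unif_topology[OF U]
      proof (intro conjI ballI)
        fix y assume "y \<in> ?N"
        then show "\<exists>E\<in>U. E `` {y} \<subseteq> ?N"
          using f by (intro bexI[of _ "{(x, y). x \<in> X \<and> y \<in> X \<and> f x = f y}"])
            (auto simp: univ_BA_iff[OF U])
      qed blast
      moreover have "x \<in> ?N"
        using x by simp
      ultimately have "eventually (\<lambda>y. y \<in> ?N) F"
        using lim unfolding limitin_def by blast
      moreover have "eventually (\<lambda>y. y \<in> S {f}) F"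
        using f by (intro ev_S) (simp add: \<J>_def)
      ultimately have "eventually (\<lambda>y. y \<in> ?N \<and> y \<in> S {f}) F"
        by (rule eventually_conj)
      then obtain y where "y \<in> ?N" "y \<in> S {f}"
        using eventually_happens'[OF F_bot] by blast
      then show ?thesis
        by (simp add: S_def)
    qed
    moreover have "\<phi> \<in> extensional (univ ?B)"
      using \<phi> by (auto simp: Z_def PiE_def)
    ultimately have "\<phi> = canon A X U x"
      by (auto simp: canon_def fun_eq_iff extensional_def)
    then show "\<phi> \<in> canon A X U ` X"
      using x by blast
  qed
qed

text \<open>Turns the embedding into an isomorphism onto Z once its image is all of Z.\<close>

lemma subspace_unif_carrier:
  assumes "unif_structure X U"
  shows "subspace_unif X U = U"
proof -
  have "subspace_unif X U = (\<lambda>E. E \<inter> X \<times> X) ` U"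
    unfolding subspace_unif_def by blast
  also have "\<dots> = (\<lambda>E. E) ` U"
    by (rule image_cong[OF refl Int_absorb2[OF unif_structure_subset[OF assms]]])
  finally show ?thesis
    by simp
qed

theorem theorem1p3:
  fixes A :: "'a set"
  assumes "infinite A"
  shows
    "(\<forall>L :: ('a opsym, 'b) algebra. L \<in> V_Omega A \<longrightarrow>
        (let B = BA A (Z A L) (Z_unif A L) in
          alg_hom (Omega_sig A) L B (rho A L) \<and>
          rho A L ` univ L = univ B \<and>
          (alg_iso (Omega_sig A) L B (rho A L) \<longleftrightarrow> partitionable A L)))
     \<and>
     (\<forall>(X :: 'x set) U. unif_structure X U \<longrightarrow>
        (let B = BA A X U; C = canon A X U in
          unif_continuous X U (Z A B) (Z_unif A B) C \<and>
          unif_topology (Z A B) (Z_unif A B) closure_of (C ` X) = Z A B \<and>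
          (unif_separated X U \<and> non_archimedean X U \<longrightarrow> inj_on C X) \<and>
          (unif_separated X U \<and> non_archimedean X U \<and>
             card_totally_bounded (cardSuc |A| ) X U \<longrightarrow>
             unif_embedding X U (Z A B) (Z_unif A B) C) \<and>
          (unif_complete X U \<and> non_archimedean X U \<and>
             card_totally_bounded (cardSuc |A| ) X U \<longrightarrow>
             unif_iso X U (Z A B) (Z_unif A B) C)))"
proof -
  have "unif_iso X U (Z A (BA A X U)) (Z_unif A (BA A X U)) (canon A X U)"
    if U: "unif_structure X U" and "unif_complete X U" "non_archimedean X U"
      "card_totally_bounded (cardSuc |A| ) X U" for X :: "'x set" and U
    using unif_embedding_canon[OF U assms _ that(3,4)] canon_surj[OF U assms that(2-4)] that(2)
    by (simp add: unif_embedding_def unif_complete_def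
        subspace_unif_carrier[OF unif_structure_Z_unif])
  note part2 = unif_continuous_canon canon_dense[OF _ assms] inj_on_canon[OF _ assms]
    unif_embedding_canon[OF _ assms] this
  show ?thesis
    unfolding Let_def
  proof (intro conjI allI impI)
    fix L :: "('a opsym, 'b) algebra"
    assume L: "L \<in> V_Omega A"
    let ?B = "BA A (Z A L) (Z_unif A L)"
    show hom: "alg_hom (Omega_sig A) L ?B (rho A L)"
      by (rule alg_hom_rho[OF L])
    show surj: "rho A L ` univ L = univ ?B"
      by (rule rho_surj[OF L assms])
    show "alg_iso (Omega_sig A) L ?B (rho A L) \<longleftrightarrow> partitionable A L"
      using hom surj inj_on_rho_iff_partitionable[OF L] by (simp add: alg_iso_def bij_betw_def)
  qed ((elim conjE)?, rule part2, assumption+)+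
qed

end
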